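(* Let $n\ge1$ be an integer, $p>1$, and $f=f(r,u)\in C^1([0,1]\times[0,\infty))$. Let $u(r)$ be any solution of $$\varphi(u'(r))'+\frac{n-1}{r}\varphi(u'(r))+f(r,u(r))=0,\quad 0<r<1,\qquad u'(0)=u(1)=0,$$ and let $w(r)$ be any solution of the corresponding linearized problem $$\bigl(\varphi'(u'(r))w'(r)\bigr)'+\frac{n-1}{r}\varphi'(u'(r))w'(r)+f_u(r,u(r))w(r)=0,\quad 0<r<1,\qquad w'(0)=w(1)=0.$$ Define $$\xi(r)=r^{n-1}\bigl[(p-1)\varphi(u'(r))w(r)-\varphi'(u'(r))u(r)w'(r)\bigr],$$ $$T(r)=r^n\bigl[(p-1)\varphi(u'(r))w'(r)+f(r,u(r))w(r)\bigr]+(n-p)r^{n-1}\varphi(u'(r))w(r).$$ Then, for $r\in(0,1)$, $$\xi'(r)=r^{n-1}w(r)\bigl[u(r)f_u(r,u(r))-(p-1)f(r,u(r))\bigr],$$ $$T'(r)=r^{n-1}w(r)\bigl[p f(r,u(r))+r f_r(r,u(r))\bigr].$$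
   Context: Here $\varphi(t)=t|t|^{p-2}$ (with $\varphi(0)=0$), $\varphi'(t)=(p-1)|t|^{p-2}$, and subscripts denote partial derivatives. Solutions $u$ are classical: $u\in C^1[0,1]$ and $\varphi(u')\in C^1(0,1]$, with values in the domain $[0,\infty)$ of $f(r,\cdot)$. Solutions $w$ of the linearized problem are in $C^1[0,1]$ with $\varphi'(u')w'$ (extended by continuity where $u'=0$) in $C^1(0,1)$. *)

theory Defs
  imports "HOL-Analysis.Analysis"
begin

definition phi :: "real \<Rightarrow> real \<Rightarrow> real" where
  "phi p t = t * \<bar>t\<bar> powr (p - 2)"

(* The case p = 2 is separate because "0 powr 0 = 0"; there the derivative of phi is
   constantly 1, also at t = 0.  For p < 2 the derivative is infinite at t = 0, and the
   value 0 given there by "powr" is never used (see flux_of). *)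
definition phi' :: "real \<Rightarrow> real \<Rightarrow> real" where
  "phi' p t = (if p = 2 then 1 else (p - 1) * \<bar>t\<bar> powr (p - 2))"

(* h is continuously differentiable on the interval S with derivative h'; the derivative
   is one-sided at the endpoints belonging to S.  (The library's C1_differentiable_on asks
   for two-sided derivatives, hence for values outside S.) *)
definition C1_on :: "real set \<Rightarrow> (real \<Rightarrow> real) \<Rightarrow> (real \<Rightarrow> real) \<Rightarrow> bool" where
  "C1_on S h h' \<longleftrightarrow>
     (\<forall>r\<in>S. (h has_real_derivative h' r) (at r within S)) \<and> continuous_on S h'"

(* f is of class C^1 on [0,1] x [0,\<infinity>) with partial derivatives fr and fu, one-sided
   on the boundary. *)
definition C1_nonlinearity ::
  "(real \<Rightarrow> real \<Rightarrow> real) \<Rightarrow> (real \<Rightarrow> real \<Rightarrow> real) \<Rightarrow> (real \<Rightarrow> real \<Rightarrow> real) \<Rightarrow> bool" where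
  "C1_nonlinearity f fr fu \<longleftrightarrow>
     (\<forall>r\<in>{0..1}. \<forall>v\<in>{0..}. ((\<lambda>s. f s v) has_real_derivative fr r v) (at r within {0..1})) \<and>
     (\<forall>r\<in>{0..1}. \<forall>v\<in>{0..}. (f r has_real_derivative fu r v) (at v within {0..})) \<and>
     continuous_on ({0..1} \<times> {0..}) (\<lambda>(r, v). f r v) \<and>
     continuous_on ({0..1} \<times> {0..}) (\<lambda>(r, v). fr r v) \<and>
     continuous_on ({0..1} \<times> {0..}) (\<lambda>(r, v). fu r v)"

definition radial_solution ::
  "nat \<Rightarrow> real \<Rightarrow> (real \<Rightarrow> real \<Rightarrow> real) \<Rightarrow> (real \<Rightarrow> real) \<Rightarrow> (real \<Rightarrow> real) \<Rightarrow> bool" where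
  "radial_solution n p f u u' \<longleftrightarrow>
     C1_on {0..1} u u' \<and> (\<forall>r\<in>{0..1}. 0 \<le> u r) \<and>
     (\<exists>d. C1_on {0<..1} (\<lambda>r. phi p (u' r)) d \<and>
          (\<forall>r\<in>{0<..<1}. d r + (real n - 1) / r * phi p (u' r) + f r (u r) = 0)) \<and>
     u' 0 = 0 \<and> u 1 = 0"

(* g is the product phi'(u') w' on (0,1), extended by continuity to the points where it is
   undefined, i.e. where p < 2 and u' = 0. *)
definition flux_of ::
  "real \<Rightarrow> (real \<Rightarrow> real) \<Rightarrow> (real \<Rightarrow> real) \<Rightarrow> (real \<Rightarrow> real) \<Rightarrow> bool" where
  "flux_of p u' w' g \<longleftrightarrow>
     continuous_on {0<..<1} g \<and>
     (\<forall>r\<in>{0<..<1}. p \<ge> 2 \<or> u' r \<noteq> 0 \<longrightarrow> g r = phi' p (u' r) * w' r)"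

definition linearized_solution ::
  "nat \<Rightarrow> real \<Rightarrow> (real \<Rightarrow> real \<Rightarrow> real) \<Rightarrow> (real \<Rightarrow> real) \<Rightarrow> (real \<Rightarrow> real) \<Rightarrow>
   (real \<Rightarrow> real) \<Rightarrow> (real \<Rightarrow> real) \<Rightarrow> (real \<Rightarrow> real) \<Rightarrow> bool" where
  "linearized_solution n p fu u u' w w' g \<longleftrightarrow>
     C1_on {0..1} w w' \<and> flux_of p u' w' g \<and>
     (\<exists>d. C1_on {0<..<1} g d \<and>
          (\<forall>r\<in>{0<..<1}. d r + (real n - 1) / r * g r + fu r (u r) * w r = 0)) \<and>
     w' 0 = 0 \<and> w 1 = 0"

(* Here g stands for phi'(u') w', see flux_of. *)
definition xi ::
  "nat \<Rightarrow> real \<Rightarrow> (real \<Rightarrow> real) \<Rightarrow> (real \<Rightarrow> real) \<Rightarrow> (real \<Rightarrow> real) \<Rightarrow> (real \<Rightarrow> real) \<Rightarrow> real \<Rightarrow> real" where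
  "xi n p u u' w g r = r ^ (n - 1) * ((p - 1) * phi p (u' r) * w r - u r * g r)"

definition T ::
  "nat \<Rightarrow> real \<Rightarrow> (real \<Rightarrow> real \<Rightarrow> real) \<Rightarrow> (real \<Rightarrow> real) \<Rightarrow> (real \<Rightarrow> real) \<Rightarrow>
   (real \<Rightarrow> real) \<Rightarrow> (real \<Rightarrow> real) \<Rightarrow> real \<Rightarrow> real" where
  "T n p f u u' w w' r =
     r ^ n * ((p - 1) * phi p (u' r) * w' r + f r (u r) * w r)
     + (real n - p) * r ^ (n - 1) * phi p (u' r) * w r"

end

theory Submission imports Defs begin

text \<open>
  Multiply each equation by \<^term>\<open>r ^ (n - 1)\<close>, so that its first two terms combine into the
  derivative of \<^term>\<open>r ^ (n - 1)\<close> times a flux: \<open>\<Phi> = phi p (u')\<close> for the equation of \<open>u\<close>, and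
  \<open>g = phi' p (u') w'\<close> for the linearized one. Homogeneity of \<open>phi p\<close> gives the identity
  \<open>(p - 1) \<Phi> w' = u' g\<close> (lemma \<open>flux_mult\<close>). In the derivative of \<open>xi\<close> the products of first
  derivatives cancel by this identity, and what is left is read off from the two equations.

  The derivative of \<open>T\<close> needs more care, because \<open>T\<close> contains \<open>(p - 1) \<Phi> w'\<close>, where \<open>\<Phi>\<close> is \<open>C\<^sup>1\<close>
  but \<open>w'\<close> is merely continuous. The same product written as \<open>u' g\<close> has the same defect in the
  factor \<open>u'\<close>. Formally, \<open>(u' g)' = u'' g + u' g'\<close> and \<open>u'' g = u'' phi' p (u') w' = \<Phi>' w'\<close>, so
  the expected derivative is \<open>\<Phi>' w' + u' g'\<close>. Lemma \<open>energy_product_derivative\<close> shows that this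
  holds at every interior point:

  \<^item> Where \<open>u'\<close> does not vanish, or everywhere if \<open>p = 2\<close>, \<open>u'\<close> is itself differentiable: it
    is recovered from \<open>\<Phi>\<close> by the function \<open>phi q\<close> with the conjugate exponent \<open>q = p / (p - 1)\<close>,
    and the formal computation is valid.
  \<^item> At a zero of \<open>u'\<close> with \<open>p \<noteq> 2\<close>, both factorizations can be differentiated, since a product is
    differentiable at a zero of one differentiable factor if the other factor is continuous. Seen
    as \<open>u' g\<close>, the product has derivative \<open>0\<close>: for \<open>p < 2\<close> since \<open>phi q\<close> has slope \<open>0\<close> at the
    origin, for \<open>p > 2\<close> since \<open>g\<close> vanishes together with \<open>u'\<close>. Seen as \<open>(p - 1) \<Phi> w'\<close>, it has
    derivative \<open>(p - 1) \<Phi>' w'\<close>. Hence \<open>\<Phi>' w' = 0\<close>, and the formula holds with both sides \<open>0\<close>.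
\<close>

section \<open>Derivatives at interior points and at zeros of a factor\<close>

lemma C1_on_interior:
  assumes "C1_on S h h'" "x \<in> interior S"
  shows "(h has_real_derivative h' x) (at x)" "isCont h' x"
  using assms interior_subset[of S]
  by (auto simp: C1_on_def continuous_on_interior) (metis at_within_interior subsetD)

text \<open>
  The difference quotient of the product at a zero of \<open>h\<close> is that of \<open>h\<close> times \<open>k\<close>, so continuity
  of \<open>k\<close> is enough. Caratheodory's form of the derivative says this without quotients.
\<close>
lemma DERIV_mult_zero_isCont:
  fixes h k :: "real \<Rightarrow> real"
  assumes h: "(h has_real_derivative D) (at x)" and "h x = 0" and k: "isCont k x"
  shows "((\<lambda>y. h y * k y) has_real_derivative D * k x) (at x)"
proof -
  obtain q where q: "\<And>y. h y = q y * (y - x)" "isCont q x" "q x = D"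
    using h \<open>h x = 0\<close> unfolding CARAT_DERIV by auto
  show ?thesis
    unfolding CARAT_DERIV
    using q k \<open>h x = 0\<close>
    by (intro exI[of _ "\<lambda>y. q y * k y"]) (auto intro: continuous_intros)
qed

section \<open>The odd power function and its inverse\<close>

lemma phi_zero [simp]: "phi p 0 = 0"
  by (simp add: phi_def)

lemma phi_eq_0_iff [simp]: "phi p t = 0 \<longleftrightarrow> t = 0"
  by (simp add: phi_def)

lemma phi_mult: "(p - 1) * phi p t = t * phi' p t"
  by (simp add: phi_def phi'_def)

lemma has_real_derivative_phi:
  assumes "p \<ge> 2 \<or> t \<noteq> 0"
  shows "(phi p has_real_derivative phi' p t) (at t)"
proof (cases "t = 0")
  case False
  \<comment> \<open>On the side of the origin where \<open>t\<close> lies, \<open>\<bar>s\<bar> = sgn t * s\<close>, which is linear in \<open>s\<close>.\<close>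
  have "((\<lambda>s. s * (sgn t * s) powr (p - 2)) has_real_derivative
          \<bar>t\<bar> powr (p - 2) + t * ((p - 2) * \<bar>t\<bar> powr (p - 2 - 1) * sgn t)) (at t)"
    using False
    by (auto intro!: derivative_eq_intros simp: abs_sgn mult.commute sgn_if split: if_splits)
  moreover have "\<bar>t\<bar> powr (p - 2) + t * ((p - 2) * \<bar>t\<bar> powr (p - 2 - 1) * sgn t) = phi' p t"
    using False
    by (auto simp: phi'_def powr_diff sgn_if divide_simps)
      (simp_all add: algebra_simps power2_eq_square power3_eq_cube)
  moreover have "\<forall>\<^sub>F s in nhds t. s * (sgn t * s) powr (p - 2) = phi p s"
  proof -
    have "\<forall>\<^sub>F s in nhds t. 0 < sgn t * s"
      by (rule order_tendstoD(1)[where y = "sgn t * t"])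
        (use False in \<open>auto intro!: tendsto_intros filterlim_ident simp: sgn_if\<close>)
    then show ?thesis
      by eventually_elim (use False in \<open>auto simp: phi_def sgn_if split: if_splits\<close>)
  qed
  ultimately show ?thesis
    using DERIV_cong_ev[of t t "\<lambda>s. s * (sgn t * s) powr (p - 2)" "phi p"] by simp
next
  case True
  show ?thesis
  proof (cases "p = 2")
    case True
    then have "phi p = (\<lambda>s. s)"
      by (auto simp: phi_def)
    then show ?thesis
      using True by (simp add: phi'_def)
  next
    case False
    with assms True have "p > 2" by auto
    then have "isCont (\<lambda>s::real. \<bar>s\<bar> powr (p - 2)) 0"
      by (auto simp: isCont_def intro!: tendsto_eq_intros tendsto_powr')
    from DERIV_mult_zero_isCont[OF DERIV_ident _ this]
    show ?thesis
      using True False by (simp add: phi'_def phi_def[abs_def])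
  qed
qed

text \<open>
  With \<open>q = p / (p - 1)\<close>, that is \<open>(p - 1) (q - 1) = 1\<close>, the odd power functions
  \<open>sgn t \<bar>t\<bar> powr (p - 1)\<close> and \<open>sgn t \<bar>t\<bar> powr (q - 1)\<close> are inverse to each other. Where \<open>phi q\<close>
  is differentiable, it carries the differentiability of \<open>phi p (u')\<close> over to \<open>u'\<close>.
\<close>
lemma phi_conjugate:
  assumes "p > 1"
  shows "phi (p / (p - 1)) (phi p t) = t"
proof (cases "t = 0")
  case False
  have e: "(p - 2) + (p - 1) * (p / (p - 1) - 2) = 0"
    using assms by (simp add: field_simps)
  have "\<bar>t * \<bar>t\<bar> powr (p - 2)\<bar> = \<bar>t\<bar> powr (p - 1)"
    using False by (simp add: abs_mult powr_mult_base)
  then have "phi (p / (p - 1)) (phi p t) = t * \<bar>t\<bar> powr ((p - 2) + (p - 1) * (p / (p - 1) - 2))"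
    by (simp only: phi_def powr_powr powr_add mult.assoc)
  with e False show ?thesis by simp
qed simp

lemma phi'_conjugate:
  assumes "p > 1" and "p = 2 \<or> t \<noteq> 0"
  shows "phi' (p / (p - 1)) (phi p t) * phi' p t = 1"
proof (cases "t = 0")
  case True
  then show ?thesis using assms by (simp add: phi'_def)
next
  case False
  let ?q = "p / (p - 1)"
  have "phi p t * (phi' ?q (phi p t) * phi' p t) = (?q - 1) * t * phi' p t"
    using phi_mult[of ?q "phi p t"] phi_conjugate[OF assms(1), of t]
    by (simp add: algebra_simps)
  also have "\<dots> = (?q - 1) * (p - 1) * phi p t"
    using phi_mult[of p t] by (simp add: algebra_simps)
  also have "(?q - 1) * (p - 1) = 1"
    using assms by (simp add: field_simps)
  finally show ?thesis using False by simp
qed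

section \<open>The terms of the two equations\<close>

text \<open>
  The chain rule has to be applied within the strip \<open>[0,1] \<times> [0,\<infinity>)\<close>, since the derivative in the second
  variable is one-sided wherever \<open>u\<close> touches zero. A curve that stays in the strip cannot tell
  the difference.
\<close>
lemma C1_nonlinearity_chain:
  assumes f: "C1_nonlinearity f fr fu"
    and u: "(u has_real_derivative u1) (at r)" and nn: "\<And>s. s \<in> {0..1} \<Longrightarrow> 0 \<le> u s"
    and r: "r \<in> {0<..<1}"
  shows "((\<lambda>s. f s (u s)) has_real_derivative fr r (u r) + fu r (u r) * u1) (at r)"
proof -
  have F: "((\<lambda>(s, v). f s v) has_derivative (\<lambda>(a, b). a * fr r (u r) + blinfun_scaleR_left (fu r (u r)) b))
        (at (r, u r) within {0..1} \<times> {0..})"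
  proof (rule has_derivative_partialsI)
    show "((\<lambda>s. f s (u r)) has_derivative (\<lambda>a. a * fr r (u r))) (at r within {0..1})"
      using f r nn[of r] unfolding C1_nonlinearity_def
      by (auto intro!: has_derivative_eq_rhs[OF has_field_derivative_imp_has_derivative])
    show "(f x has_derivative blinfun_apply (blinfun_scaleR_left (fu x y))) (at y within {0..})"
      if "x \<in> {0..1}" "y \<in> {0..}" for x y
      using f that unfolding C1_nonlinearity_def
      by (auto intro!: has_derivative_eq_rhs[OF has_field_derivative_imp_has_derivative])
    have "continuous_on ({0..1} \<times> {0..}) (\<lambda>(x, y). fu x y)"
      using f by (simp add: C1_nonlinearity_def)
    then show "continuous (at (r, u r) within {0..1} \<times> {0..}) (\<lambda>(x, y). blinfun_scaleR_left (fu x y))"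
      using r nn[of r]
      by (auto simp: continuous_on_def continuous_within split_def intro!: tendsto_intros)
  qed (use r nn in auto)
  have U: "((\<lambda>s. (s, u s)) has_derivative (\<lambda>a. (a, u1 * a))) (at r within {0..1})"
    using u unfolding has_field_derivative_def
    by (auto intro!: derivative_eq_intros intro: has_derivative_at_withinI)
  have strip: "((\<lambda>s. (s, u s)) ` {0..1}) \<subseteq> {0..1} \<times> {0..}"
    using nn by auto
  have "((\<lambda>s. (\<lambda>(s, v). f s v) (s, u s)) has_derivative
      (\<lambda>a. (\<lambda>(a, b). a * fr r (u r) + blinfun_scaleR_left (fu r (u r)) b) (a, u1 * a)))
        (at r within {0..1})"
    by (rule has_derivative_in_compose[OF U has_derivative_subset[OF F strip]])
  moreover have "at r within {0..1} = at r"
    using r by (intro at_within_interior) auto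
  ultimately show ?thesis
    by (auto simp: algebra_simps intro!: has_derivative_imp_has_field_derivative)
qed

text \<open>
  For \<open>p < 2\<close> the flux at a zero of \<open>u'\<close> is known only as a limit, but there both sides vanish.
\<close>
lemma flux_mult:
  assumes "flux_of p u' w' g" "r \<in> {0<..<1}"
  shows "u' r * g r = (p - 1) * phi p (u' r) * w' r"
  using assms phi_mult[of p "u' r"] by (cases "u' r = 0") (auto simp: flux_of_def)

text \<open>
  Neither of the factors \<open>u'\<close> and \<open>w'\<close> need be differentiable, but the two factorizations
  \<open>u' g = (p - 1) phi p (u') w'\<close> of the product make up for it: at every point, at least one of
  them can be differentiated. At the zeros of \<open>u'\<close> with \<open>p \<noteq> 2\<close> both can, with values that agree
  only if \<open>d * w' r = 0\<close>.
\<close>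
lemma energy_product_derivative:
  assumes p: "p > 1" and r: "r \<in> {0<..<1}" and flux: "flux_of p u' w' g"
    and P: "((\<lambda>s. phi p (u' s)) has_real_derivative d) (at r)"
    and g: "(g has_real_derivative e) (at r)"
    and u': "isCont u' r" and w': "isCont w' r"
  shows "((\<lambda>s. (p - 1) * phi p (u' s) * w' s) has_real_derivative d * w' r + u' r * e) (at r)"
proof -
  let ?q = "p / (p - 1)"
  have transfer: "((\<lambda>s. (p - 1) * phi p (u' s) * w' s) has_real_derivative D) (at r)"
    if "((\<lambda>s. u' s * g s) has_real_derivative D) (at r)" for D
    by (rule has_field_derivative_transform_within_open[OF that, where S = "{0<..<1}"])
      (use r in \<open>auto simp: flux_mult[OF flux]\<close>)
  have u'': "(u' has_real_derivative phi' ?q (phi p (u' r)) * d) (at r)"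
    if "p \<le> 2 \<or> u' r \<noteq> 0"
  proof -
    have "?q \<ge> 2 \<or> phi p (u' r) \<noteq> 0"
      using that p by (auto simp: field_simps)
    from DERIV_chain2[OF has_real_derivative_phi[OF this] P] show ?thesis
      by (simp add: phi_conjugate[OF p])
  qed
  show ?thesis
  proof (cases "p = 2 \<or> u' r \<noteq> 0")
    case True
    then have "g r = phi' p (u' r) * w' r"
      using flux r by (auto simp: flux_of_def)
    then have "phi' ?q (phi p (u' r)) * d * g r + u' r * e = d * w' r + u' r * e"
      using phi'_conjugate[OF p True] by algebra
    moreover have "((\<lambda>s. u' s * g s) has_real_derivative phi' ?q (phi p (u' r)) * d * g r + u' r * e) (at r)"
      using True by (auto intro!: derivative_eq_intros u'' g)
    ultimately show ?thesis
      using transfer by metis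
  next
    case False
    then have z: "u' r = 0" "p \<noteq> 2" by auto
    have "((\<lambda>s. u' s * g s) has_real_derivative 0) (at r)"
    proof (cases "p < 2")
      case True
      \<comment> \<open>Here the conjugate exponent exceeds \<open>2\<close>, so \<open>phi'\<close> with that exponent is \<open>0\<close> at \<open>0\<close>.\<close>
      then have "(u' has_real_derivative 0) (at r)"
        using u'' z p by (simp add: phi'_def field_simps)
      from DERIV_mult_zero_isCont[OF this z(1) DERIV_isCont[OF g]] show ?thesis by simp
    next
      case False
      then have "g r = 0"
        using flux r z by (auto simp: flux_of_def phi'_def)
      from DERIV_mult_zero_isCont[OF g this u'] show ?thesis
        using z by (simp add: mult.commute)
    qed
    then have 0: "((\<lambda>s. (p - 1) * phi p (u' s) * w' s) has_real_derivative 0) (at r)"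
      by (rule transfer)
    \<comment> \<open>The other factorization has derivative \<open>(p - 1) * d * w' r\<close>, so \<open>d * w' r\<close> must vanish.\<close>
    have "((\<lambda>s. (p - 1) * phi p (u' s) * w' s) has_real_derivative (p - 1) * d * w' r) (at r)"
      using z by (intro DERIV_mult_zero_isCont DERIV_cmult P w') auto
    with 0 have "(p - 1) * d * w' r = 0"
      using DERIV_unique by blast
    with 0 z p show ?thesis by auto
  qed
qed

section \<open>The derivatives of \<open>xi\<close> and \<open>T\<close>\<close>

theorem lemma2p4:
  fixes n :: nat and p :: real
    and f fr fu :: "real \<Rightarrow> real \<Rightarrow> real"
    and u u' w w' g :: "real \<Rightarrow> real"
  assumes "n \<ge> 1" and "p > 1"
    and "C1_nonlinearity f fr fu"
    and "radial_solution n p f u u'"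
    and "linearized_solution n p fu u u' w w' g"
  shows "\<forall>r\<in>{0<..<1}.
      (xi n p u u' w g has_real_derivative
         r ^ (n - 1) * w r * (u r * fu r (u r) - (p - 1) * f r (u r))) (at r) \<and>
      (T n p f u u' w w' has_real_derivative
         r ^ (n - 1) * w r * (p * f r (u r) + r * fr r (u r))) (at r)"
proof
  fix r :: real
  assume r: "r \<in> {0<..<1}"
  obtain m where n: "n = Suc m"
    using \<open>n \<ge> 1\<close> by (cases n) auto
  define P where "P = (\<lambda>s. phi p (u' s))"
  define c where "c = real m / r"
  define A where "A = (\<lambda>s. (p - 1) * P s * w' s)"
  obtain d where d: "C1_on {0<..1} P d"
    and ode: "d r + c * P r + f r (u r) = 0"
    using assms(4) r n unfolding radial_solution_def P_def c_def by fastforce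
  obtain e where e: "C1_on {0<..<1} g e"
    and lin: "e r + c * g r + fu r (u r) * w r = 0"
    using assms(5) r n unfolding linearized_solution_def c_def by fastforce
  have C1: "C1_on {0..1} u u'" "C1_on {0..1} w w'" and flux: "flux_of p u' w' g"
    and nn: "\<And>s. s \<in> {0..1} \<Longrightarrow> 0 \<le> u s"
    using assms(4,5) by (auto simp: radial_solution_def linearized_solution_def)
  have P: "(P has_real_derivative d r) (at r)" and g: "(g has_real_derivative e r) (at r)"
    and u: "(u has_real_derivative u' r) (at r)" "isCont u' r"
    and w: "(w has_real_derivative w' r) (at r)" "isCont w' r"
    using C1_on_interior[OF d] C1_on_interior[OF e] C1_on_interior[OF C1(1)]
      C1_on_interior[OF C1(2)] r by auto
  have F: "((\<lambda>s. f s (u s)) has_real_derivative fr r (u r) + fu r (u r) * u' r) (at r)"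
    using C1_nonlinearity_chain[OF assms(3) u(1) nn r] .
  have A: "(A has_real_derivative d r * w' r + u' r * e r) (at r)"
    using energy_product_derivative[OF assms(2) r flux P[unfolded P_def] g u(2) w(2)]
    by (simp add: A_def P_def)
  have id: "u' r * g r = (p - 1) * P r * w' r"
    using flux_mult[OF flux r] by (simp add: P_def)
  have r0: "r \<noteq> 0" using r by auto
  \<comment> \<open>Putting the derivative of the power as \<open>c * r ^ m\<close>, with the coefficient \<open>c\<close> of the
      equations, avoids the exponent \<open>m - 1\<close> and makes the final identities polynomial in \<open>c\<close>.\<close>
  have pw: "((\<lambda>s. s ^ m) has_real_derivative c * r ^ m) (at r)"
    using r0 DERIV_pow[of m r UNIV] by (cases m) (auto simp: c_def)
  have ode': "d r = - (c * P r) - f r (u r)"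
    and lin': "e r = - (c * g r) - fu r (u r) * w r"
    using ode lin by linarith+
  have "(xi n p u u' w g has_real_derivative
         r ^ (n - 1) * w r * (u r * fu r (u r) - (p - 1) * f r (u r))) (at r)"
  proof -
    have xi_eq: "xi n p u u' w g = (\<lambda>s. s ^ m * ((p - 1) * P s * w s - u s * g s))"
      by (auto simp: xi_def P_def n)
    have bracket: "((\<lambda>s. (p - 1) * P s * w s - u s * g s) has_real_derivative
        (p - 1) * (P r * w' r + d r * w r) - (u r * e r + u' r * g r)) (at r)"
      by (auto intro!: derivative_eq_intros P w(1) g u(1) simp: algebra_simps)
    have "(xi n p u u' w g has_real_derivative
        r ^ m * ((p - 1) * (P r * w' r + d r * w r) - (u r * e r + u' r * g r))
        + c * r ^ m * ((p - 1) * P r * w r - u r * g r)) (at r)"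
      unfolding xi_eq using DERIV_mult[OF pw bracket] by (simp add: ac_simps)
    moreover have "r ^ m * ((p - 1) * (P r * w' r + d r * w r) - (u r * e r + u' r * g r))
        + c * r ^ m * ((p - 1) * P r * w r - u r * g r)
        = r ^ (n - 1) * w r * (u r * fu r (u r) - (p - 1) * f r (u r))"
      by (simp only: ode' lin' id n diff_Suc_1) (simp add: algebra_simps)
    ultimately show ?thesis by simp
  qed
  moreover have "(T n p f u u' w w' has_real_derivative
         r ^ (n - 1) * w r * (p * f r (u r) + r * fr r (u r))) (at r)"
  proof -
    \<comment> \<open>The product \<open>A\<close> is kept whole, because its factor \<open>w'\<close> need not be
        differentiable.\<close>
    have T_eq: "T n p f u u' w w' = (\<lambda>s. s ^ m * (s * (A s + f s (u s) * w s) + (real n - p) * P s * w s))"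
      by (auto simp: T_def A_def P_def n algebra_simps)
    have bracket: "((\<lambda>s. s * (A s + f s (u s) * w s) + (real n - p) * P s * w s) has_real_derivative
        r * (d r * w' r + u' r * e r + (f r (u r) * w' r + (fr r (u r) + fu r (u r) * u' r) * w r))
          + (A r + f r (u r) * w r) + (real n - p) * (P r * w' r + d r * w r)) (at r)"
      by (auto intro!: derivative_eq_intros P w(1) A F simp: algebra_simps)
    have "(T n p f u u' w w' has_real_derivative
        r ^ m * (r * (d r * w' r + u' r * e r + (f r (u r) * w' r + (fr r (u r) + fu r (u r) * u' r) * w r))
          + (A r + f r (u r) * w r) + (real n - p) * (P r * w' r + d r * w r))
        + c * r ^ m * (r * (A r + f r (u r) * w r) + (real n - p) * P r * w r)) (at r)"
      unfolding T_eq using DERIV_mult[OF pw bracket] by (simp add: ac_simps)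
    moreover have "r ^ m * (r * (d r * w' r + u' r * e r + (f r (u r) * w' r + (fr r (u r) + fu r (u r) * u' r) * w r))
          + (A r + f r (u r) * w r) + (real n - p) * (P r * w' r + d r * w r))
        + c * r ^ m * (r * (A r + f r (u r) * w r) + (real n - p) * P r * w r)
        = r ^ (n - 1) * w r * (p * f r (u r) + r * fr r (u r))"
      (is "?L = ?R")
    proof -
      have "u' r * e r = - c * A r - fu r (u r) * w r * u' r"
        unfolding lin' A_def id[symmetric] by (simp add: algebra_simps)
      moreover have "real n = 1 + c * r"
        using r0 by (simp add: c_def n)
      ultimately show ?thesis
        by (simp only: ode' A_def diff_Suc_1 n) (simp add: algebra_simps)
    qed
    ultimately show ?thesis by simp
  qed
  ultimately show "(xi n p u u' w g has_real_derivative
         r ^ (n - 1) * w r * (u r * fu r (u r) - (p - 1) * f r (u r))) (at r) \<and>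
      (T n p f u u' w w' has_real_derivative
         r ^ (n - 1) * w r * (p * f r (u r) + r * fr r (u r))) (at r)" ..
qed

end
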